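(* As formal power series in $z$ with coefficients polynomials in $s$: (A) $$\sum_{k=0}^{\infty}h_{GZ(1\,2\,3^k)}(s)\,z^k=\frac{-sz+s+1}{(1-z)(1-sz)\bigl(s^2z^2-(s^2+s)z+1\bigr)};$$ (B) $$\sum_{k=0}^{\infty}h_{GZ(2^2\,3^k)}(s)\,z^k=\frac{1}{(1-z)\bigl(s^2z^2-(s^2+s)z+1\bigr)}.$$
   Context: Gelfand–Zetlin polytope: for real numbers $\lambda_1\le\dots\le\lambda_s$, $GZ(\lambda_1\dots\lambda_s)\subset\mathbb{R}^{s(s-1)/2}$ is the convex polytope of all points with coordinates $u_{i,j}$ ($1\le i\le s-1$, $1\le j\le s-i$) satisfying $u_{i-1,j}\le u_{i,j}\le u_{i-1,j+1}$ for all such $i,j$, where $u_{0,j}:=\lambda_j$. Multiplicative notation is used for repetitions: $GZ(1\,2\,3^k)$ is the polytope of the sequence $1,2,3,\dots,3$ and $GZ(2^2\,3^k)$ that of $2,2,3,\dots,3$, each with $k$ copies of $3$ (for $k=0$: $GZ(1\,2)$, a segment, and $GZ(2\,2)$, a point). For a polytope $P$ of dimension $n$, $f_P(t)=\sum_{d=0}^n f_d t^d$, where $f_d$ is the number of $d$-dimensional faces of $P$ (nonempty faces, $P$ itself included, so $f_n=1$). The $h$-polynomial of $P$ is defined (for arbitrary, not necessarily simple, $P$) by $h_P(s)=f_P(s-1)$. *)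

theory Defs
  imports
    "HOL-Analysis.Analysis"
    "HOL-Library.Function_Algebras"
    "HOL-Computational_Algebra.Formal_Power_Series"
begin

text \<open>The polytopes below live in spaces whose dimension varies with the length of the defining
  sequence. They are all placed in one ambient real vector space, that of functions with pointwise
  operations, where the coordinates not in use are required to vanish.\<close>

instantiation "fun" :: (type, real_vector) real_vector
begin

definition scaleR_fun :: "real \<Rightarrow> ('a \<Rightarrow> 'b) \<Rightarrow> 'a \<Rightarrow> 'b" where
  "scaleR_fun c f = (\<lambda>x. c *\<^sub>R f x)"

instance
  by standard (auto simp: scaleR_fun_def fun_eq_iff scaleR_add_right scaleR_add_left)

end

lemma scaleR_fun_apply [simp]: "(c *\<^sub>R f) x = c *\<^sub>R f x"
  by (simp add: scaleR_fun_def)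

text \<open>The library's \<^const>\<open>aff_dim\<close> is restricted to Euclidean spaces; this is the same
  notion for nonempty sets in an arbitrary real vector space (see the lemma that follows).\<close>

definition affine_dimension :: "'a::real_vector set \<Rightarrow> nat" where
  "affine_dimension S = dim {x - y | x y. x \<in> S \<and> y \<in> S}"

lemma affine_dimension_eq_aff_dim:
  fixes S :: "'a::euclidean_space set"
  assumes "S \<noteq> {}"
  shows "int (affine_dimension S) = aff_dim S"
proof -
  obtain a where a: "a \<in> S" using assms by blast
  let ?T = "(\<lambda>x. x - a) ` S"
  let ?D = "{x - y | x y. x \<in> S \<and> y \<in> S}"
  have "x - y \<in> span ?T" if "x \<in> S" "y \<in> S" for x y
  proof -
    have "(x - a) - (y - a) \<in> span ?T"
      using that by (intro span_diff span_base) auto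
    then show ?thesis by simp
  qed
  then have "?D \<subseteq> span ?T" by blast
  moreover have "?T \<subseteq> ?D" using a by blast
  then have "?T \<subseteq> span ?D" using span_superset by blast
  ultimately have "span ?D = span ?T" by (simp only: span_eq)
  then have "dim {x - y | x y. x \<in> S \<and> y \<in> S} = dim ?T"
    by (rule span_eq_dim)
  then show ?thesis
    using aff_dim_eq_dim_subtract[of a S] a by (simp add: affine_dimension_def hull_inc)
qed

definition f_poly :: "'a::real_vector set \<Rightarrow> int poly" where
  "f_poly P = (\<Sum>d\<le>affine_dimension P.
     monom (int (card {F. F face_of P \<and> F \<noteq> {} \<and> affine_dimension F = d})) d)"

definition h_poly :: "'a::real_vector set \<Rightarrow> int poly" where
  "h_poly P = pcompose (f_poly P) [:-1, 1:]"

text \<open>The sequence \<open>\<lambda>\<^sub>1, \<dots>, \<lambda>\<^sub>s\<close> is a list, so \<open>\<lambda>\<^sub>j\<close> is its entry at position \<open>j - 1\<close>.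
  It occupies row 0 of the array but is not a coordinate of the points.\<close>

definition gz_entry :: "real list \<Rightarrow> (nat \<Rightarrow> nat \<Rightarrow> real) \<Rightarrow> nat \<Rightarrow> nat \<Rightarrow> real" where
  "gz_entry lam u i j = (if i = 0 then lam ! (j - 1) else u i j)"

definition gz_index :: "nat \<Rightarrow> (nat \<times> nat) set" where
  "gz_index s = {(i, j). 1 \<le> i \<and> i \<le> s - 1 \<and> 1 \<le> j \<and> j \<le> s - i}"

definition GZ :: "real list \<Rightarrow> (nat \<Rightarrow> nat \<Rightarrow> real) set" where
  "GZ lam = {u.
     (\<forall>i j. (i, j) \<notin> gz_index (length lam) \<longrightarrow> u i j = 0) \<and>
     (\<forall>(i, j) \<in> gz_index (length lam).
        gz_entry lam u (i - 1) j \<le> u i j \<and> u i j \<le> gz_entry lam u (i - 1) (j + 1))}"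

text \<open>Quotients by a power series with constant term 1. The library's division of power series
  needs coefficients in a field, which polynomials do not form.\<close>

definition fps_quotient :: "'a::comm_ring_1 fps \<Rightarrow> 'a fps \<Rightarrow> 'a fps" where
  "fps_quotient N D = N * fps_right_inverse D 1"

lemma fps_quotient_iff:
  assumes "fps_nth D 0 = 1"
  shows "G = fps_quotient N D \<longleftrightarrow> G * D = N"
proof -
  have inv: "D * fps_right_inverse D 1 = 1"
    using assms by (intro fps_right_inverse) simp
  show ?thesis
  proof
    assume "G = fps_quotient N D"
    then have "G * D = N * (D * fps_right_inverse D 1)"
      unfolding fps_quotient_def by (simp only: mult.assoc mult.commute mult.left_commute)
    then show "G * D = N" using inv by simp
  next
    assume "G * D = N"
    then have "fps_quotient N D = G * (D * fps_right_inverse D 1)"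
      unfolding fps_quotient_def mult.assoc[symmetric] by simp
    then show "G = fps_quotient N D" using inv by simp
  qed
qed

end

(* A nonempty face of a polyhedron is determined by the set of inequalities that are tight in its
   relative interior, and its direction space is cut out by the linear parts of these. Every entry of
   the arrays in GZ(l, 2, 3^k) from the third column on equals 3, so a point is a pair of chains
   x_i = u_{i,1} and y_i = u_{i-1,2} with y_i in [y_{i-1}, 3] and x_i in [x_{i-1}, y_i]. Which of the
   four inequalities at step i+1 can be tight depends only on whether x_i = y_i and whether
   y_i = 3, so the tight sets are the words of a four-state automaton, and the dimension of a face is
   the number of entries that are at neither end of their interval. With t = s - 1 marking these
   entries, the h-polynomials satisfy the transfer recurrences of the automaton. *)

theory Submission
  imports Defs
begin

section \<open>Dimension from a set of coordinate functionals\<close>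

text \<open>Vectors of \<open>V\<close> dual to the functionals \<open>r c\<close> form a basis:
  \<open>r c\<close> reads off the coefficient at \<open>b c\<close>, and a vector minus its
  expansion has all coordinates zero. The finite spanning set is returned as well, since the ambient
  space may be infinite-dimensional.\<close>

lemma coordinate_basis:
  fixes r :: "'c \<Rightarrow> 'v::real_vector \<Rightarrow> real"
  assumes V: "subspace V" and fin: "finite S"
    and lin: "\<And>c. c \<in> S \<Longrightarrow> linear (r c)"
    and sep: "\<And>v. v \<in> V \<Longrightarrow> (\<And>c. c \<in> S \<Longrightarrow> r c v = 0) \<Longrightarrow> v = 0"
    and ext: "\<And>g :: 'c \<Rightarrow> real. \<exists>v\<in>V. \<forall>c\<in>S. r c v = g c"
  obtains B where "finite B" "V \<subseteq> span B" "dim V = card S"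
proof -
  have "\<forall>c. \<exists>v. v \<in> V \<and> (\<forall>c'\<in>S. r c' v = (if c' = c then 1 else 0))"
  proof
    fix c show "\<exists>v. v \<in> V \<and> (\<forall>c'\<in>S. r c' v = (if c' = c then 1 else 0))"
      using ext[of "\<lambda>c'. if c' = c then 1 else 0"] by blast
  qed
  then obtain b where bV: "\<And>c. b c \<in> V"
    and rb: "\<And>c c'. c' \<in> S \<Longrightarrow> r c' (b c) = (if c' = c then 1 else 0)"
    by metis
  have inj: "inj_on b S"
    by (rule inj_onI) (metis rb zero_neq_one)
  have r_sum: "r c (\<Sum>c'\<in>S. f c' *\<^sub>R b c') = f c" if "c \<in> S" for c f
  proof -
    have "r c (\<Sum>c'\<in>S. f c' *\<^sub>R b c') = (\<Sum>c'\<in>S. f c' * r c (b c'))"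
      using lin[OF that] by (simp add: linear_sum linear_scale)
    also have "\<dots> = (\<Sum>c'\<in>S. if c = c' then f c' else 0)"
      using that by (intro sum.cong) (auto simp: rb)
    finally show ?thesis using fin that by simp
  qed
  have "independent (b ` S)"
  proof (rule independent_if_scalars_zero)
    fix f x assume f: "(\<Sum>x\<in>b ` S. f x *\<^sub>R x) = 0" and "x \<in> b ` S"
    then obtain c where c: "c \<in> S" "x = b c" by blast
    have "(\<Sum>c\<in>S. f (b c) *\<^sub>R b c) = 0"
      using f by (simp add: sum.reindex[OF inj])
    then show "f x = 0"
      using r_sum[OF c(1), of "f \<circ> b"] c lin[OF c(1)] by (simp add: linear_0)
  qed (use fin in simp)
  moreover have "V \<subseteq> span (b ` S)"
  proof
    fix v assume v: "v \<in> V"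
    let ?w = "\<Sum>c\<in>S. r c v *\<^sub>R b c"
    have w: "?w \<in> V"
      using bV V by (intro subspace_sum subspace_scale) auto
    have "v - ?w = 0"
      using v w V by (intro sep subspace_diff) (auto simp: linear_diff[OF lin] r_sum)
    moreover have "?w \<in> span (b ` S)"
      by (intro span_sum span_scale span_base) auto
    ultimately show "v \<in> span (b ` S)" by simp
  qed
  moreover have "b ` S \<subseteq> V" using bV by blast
  moreover have "card (b ` S) = card S" by (rule card_image[OF inj])
  ultimately show ?thesis
    using that[of "b ` S"] fin dim_unique by blast
qed

section \<open>Faces of polyhedra and tight inequalities\<close>

text \<open>A polyhedron inside the affine space \<open>u0 + V\<close>: coordinates with forced
  values are absorbed by \<open>u0\<close> and \<open>V\<close>, so that only inequalities
  \<open>0 \<le> g a u\<close> remain. The map \<open>L a\<close> is the linear part of the affine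
  function \<open>g a\<close>.\<close>

locale polyhedron_presentation =
  fixes V :: "'v::real_vector set" and u0 :: 'v and A :: "'a set"
    and g L :: "'a \<Rightarrow> 'v \<Rightarrow> real"
  assumes V: "subspace V" and finA: "finite A"
    and L: "\<And>a. a \<in> A \<Longrightarrow> linear (L a)"
    and g: "\<And>a u c v. a \<in> A \<Longrightarrow> g a (u + c *\<^sub>R v) = g a u + c * L a v"
begin

definition P where "P = {u. u - u0 \<in> V \<and> (\<forall>a\<in>A. 0 \<le> g a u)}"
definition tight where "tight u = {a \<in> A. g a u = 0}"
definition tight_dir where "tight_dir u = {v \<in> V. \<forall>a\<in>tight u. L a v = 0}"
text \<open>For \<open>u\<close> in \<open>P\<close> this is the smallest face of \<open>P\<close>
  that contains \<open>u\<close>.\<close>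

definition face where "face u = {w \<in> P. tight u \<subseteq> tight w}"

lemma L_diff: "a \<in> A \<Longrightarrow> L a (w - u) = g a w - g a u"
  using g[of a u 1 "w - u"] by simp

lemma diff_in_V: "u \<in> P \<Longrightarrow> w \<in> P \<Longrightarrow> w - u \<in> V"
  using subspace_diff[OF V, of "w - u0" "u - u0"] by (simp add: P_def)

text \<open>Tight inequalities stay tight along \<open>v\<close>; the others are strict at
  \<open>u\<close> and finite in number, so they survive a short move.\<close>

lemma push:
  assumes u: "u \<in> P" and v: "v \<in> tight_dir u"
  obtains \<epsilon> where "\<epsilon> > 0" "u + \<epsilon> *\<^sub>R v \<in> face u"
proof -
  have "\<forall>\<^sub>F \<epsilon> in at_right 0. \<forall>a\<in>A. 0 \<le> g a u + \<epsilon> * L a v"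
  proof (rule eventually_ball_finite[OF finA], rule ballI)
    fix a assume a: "a \<in> A"
    show "\<forall>\<^sub>F \<epsilon> in at_right 0. 0 \<le> g a u + \<epsilon> * L a v"
    proof (cases "a \<in> tight u")
      case True
      then show ?thesis using v by (simp add: tight_def tight_dir_def)
    next
      case False
      then have "0 < g a u + 0 * L a v"
        using a u by (auto simp: tight_def P_def less_le)
      moreover have "((\<lambda>\<epsilon>. g a u + \<epsilon> * L a v) \<longlongrightarrow> g a u + 0 * L a v) (at_right 0)"
        by (intro tendsto_intros)
      ultimately have "\<forall>\<^sub>F \<epsilon> in at_right 0. 0 < g a u + \<epsilon> * L a v"
        by (rule order_tendstoD(1)[rotated])
      then show ?thesis by (rule eventually_mono) simp
    qed
  qed
  moreover have "\<forall>\<^sub>F \<epsilon> in at_right (0::real). 0 < \<epsilon>"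
    by (rule eventually_at_right_less)
  ultimately obtain \<epsilon> :: real where e: "\<epsilon> > 0" "\<forall>a\<in>A. 0 \<le> g a u + \<epsilon> * L a v"
    using eventually_happens'[OF trivial_limit_at_right_real eventually_conj] by blast
  have "(u - u0) + \<epsilon> *\<^sub>R v \<in> V"
    using u v V by (intro subspace_add subspace_scale) (auto simp: P_def tight_dir_def)
  then have "u + \<epsilon> *\<^sub>R v \<in> face u"
    using e v by (auto simp: face_def P_def tight_def tight_dir_def g algebra_simps)
  then show ?thesis using that e by blast
qed

lemma g_convex:
  "a \<in> A \<Longrightarrow> g a ((1 - t) *\<^sub>R x + t *\<^sub>R y) = (1 - t) * g a x + t * g a y"
  using g[of a x t "y - x"] L_diff[of a y x] by (simp add: algebra_simps)

lemma combination_in_P: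
  assumes "x \<in> P" "y \<in> P" "0 \<le> t" "t \<le> 1"
  shows "(1 - t) *\<^sub>R x + t *\<^sub>R y \<in> P"
proof -
  have "(1 - t) *\<^sub>R (x - u0) + t *\<^sub>R (y - u0) \<in> V"
    using assms V by (intro subspace_add subspace_scale) (auto simp: P_def)
  moreover have "(1 - t) *\<^sub>R (x - u0) + t *\<^sub>R (y - u0) = (1 - t) *\<^sub>R x + t *\<^sub>R y - u0"
    by (simp add: algebra_simps)
  ultimately show ?thesis
    using assms by (simp add: P_def g_convex)
qed

text \<open>A sum of two nonnegative terms with positive weights vanishes only if both terms
  do.\<close>

lemma tight_combination:
  assumes "x \<in> P" "y \<in> P" "0 < t" "t < 1"
  shows "tight ((1 - t) *\<^sub>R x + t *\<^sub>R y) = tight x \<inter> tight y"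
proof -
  have "(1 - t) * g a x + t * g a y = 0 \<longleftrightarrow> g a x = 0 \<and> g a y = 0" if "a \<in> A" for a
    using assms that by (subst add_nonneg_eq_0_iff) (auto simp: P_def)
  then show ?thesis by (auto simp: tight_def g_convex)
qed

text \<open>Convexity holds because \<open>g a\<close> is affine; the endpoint condition is
  \<open>tight_combination\<close>, as a tight inequality inside a segment is tight at both
  ends.\<close>

lemma face_face_of: "face u face_of P"
proof -
  have "(1 - t) *\<^sub>R x + t *\<^sub>R y \<in> face u" if "x \<in> face u" "y \<in> face u" "0 \<le> t" "t \<le> 1" for x y t
  proof -
    have "tight u \<subseteq> tight ((1 - t) *\<^sub>R x + t *\<^sub>R y)"
    proof
      fix a assume "a \<in> tight u"
      then have "a \<in> tight x" "a \<in> tight y" using that by (auto simp: face_def)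
      then show "a \<in> tight ((1 - t) *\<^sub>R x + t *\<^sub>R y)" by (simp add: tight_def g_convex)
    qed
    then show ?thesis using that by (simp add: face_def combination_in_P)
  qed
  then have "convex (face u)" unfolding convex_alt by blast
  moreover have "a \<in> face u \<and> b \<in> face u"
    if "a \<in> P" "b \<in> P" "x \<in> face u" and x: "x \<in> open_segment a b" for a b x
  proof -
    obtain t where "0 < t" "t < 1" "x = (1 - t) *\<^sub>R a + t *\<^sub>R b"
      using x unfolding in_segment by blast
    then show ?thesis using that tight_combination[of a b t] by (auto simp: face_def)
  qed
  moreover have "face u \<subseteq> P" by (auto simp: face_def)
  ultimately show ?thesis unfolding face_of_def by blast
qed

lemma face_of_imp_face:
  assumes F: "F face_of P" and "F \<noteq> {}"
  obtains u where "u \<in> P" "F = face u"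
proof -
  have FP: "F \<subseteq> P" using F by (simp add: face_of_def)
  obtain u where u: "u \<in> F" and min: "\<And>w. w \<in> F \<Longrightarrow> card (tight u) \<le> card (tight w)"
    using ex_has_least_nat[of "\<lambda>u. u \<in> F" _ "\<lambda>u. card (tight u)"] \<open>F \<noteq> {}\<close> by blast
  \<comment> \<open>A point of \<open>F\<close> with the fewest tight inequalities is in its relative interior.\<close>
  have "F = face u"
  proof (intro equalityI subsetI)
    fix w assume w: "w \<in> F"
    \<comment> \<open>Only common tight inequalities remain tight at the midpoint, so minimality
      gives \<open>tight u \<subseteq> tight w\<close>.\<close>
    let ?m = "(1 - 1/2) *\<^sub>R u + (1/2) *\<^sub>R w"
    have "?m \<in> F"
      using F u w by (intro convexD_alt) (auto simp: face_of_def)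
    moreover have "tight ?m = tight u \<inter> tight w"
      using u w FP by (intro tight_combination) auto
    ultimately have "card (tight u) \<le> card (tight u \<inter> tight w)" using min by metis
    moreover have "finite (tight u)" using finA by (simp add: tight_def)
    ultimately have "tight u \<inter> tight w = tight u"
      by (intro card_seteq) auto
    then show "w \<in> face u" using w FP by (auto simp: face_def)
  next
    fix w assume w: "w \<in> face u"
    show "w \<in> F"
    proof (cases "w = u")
      case False
      \<comment> \<open>The segment from \<open>w\<close> to \<open>u\<close> can be prolonged
        beyond \<open>u\<close> within the face. Then \<open>u\<close> is interior to a segment in
        \<open>P\<close>, and the face property puts \<open>w\<close> into \<open>F\<close>.\<close>
      have "u - w \<in> tight_dir u"
        using w u FP diff_in_V[of w u] by (auto simp: tight_dir_def face_def tight_def L_diff subset_eq)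
      then obtain \<epsilon> where e: "\<epsilon> > 0" "u + \<epsilon> *\<^sub>R (u - w) \<in> face u"
        using push u FP by blast
      let ?w' = "u + \<epsilon> *\<^sub>R (u - w)"
      have "u = (1 - 1 / (1 + \<epsilon>)) *\<^sub>R w + (1 / (1 + \<epsilon>)) *\<^sub>R ?w'"
      proof -
        have "(1 - 1 / (1 + \<epsilon>)) = \<epsilon> / (1 + \<epsilon>)" using e by (simp add: field_simps)
        moreover have "(1 + \<epsilon>) *\<^sub>R u = (1 + \<epsilon>) *\<^sub>R ((\<epsilon> / (1 + \<epsilon>)) *\<^sub>R w + (1 / (1 + \<epsilon>)) *\<^sub>R ?w')"
          using e by (simp add: scaleR_add_right) (simp add: algebra_simps)
        ultimately show ?thesis using e by (simp only: scaleR_cancel_left) auto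
      qed
      moreover have "w \<noteq> ?w'"
      proof
        assume "w = ?w'"
        then have "(1 + \<epsilon>) *\<^sub>R (u - w) = 0" by (simp add: algebra_simps)
        then show False using e False by auto
      qed
      moreover have "0 < 1 / (1 + \<epsilon>)" "1 / (1 + \<epsilon>) < 1" using e by auto
      ultimately have "u \<in> open_segment w ?w'" unfolding in_segment by blast
      moreover have "?w' \<in> P" "w \<in> P" using e w by (auto simp: face_def)
      ultimately show ?thesis using F u unfolding face_of_def by blast
    qed (use u in simp)
  qed
  then show ?thesis using that u FP by blast
qed

lemma subspace_tight_dir: "subspace (tight_dir u)"
  using V L unfolding tight_dir_def subspace_def tight_def
  by (auto simp: linear_0 linear_add linear_scale)

text \<open>Differences of points of the face satisfy the tight equations; conversely
  \<open>push\<close> realizes every such direction, up to scaling, as a difference from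
  \<open>u\<close>.\<close>

lemma affine_dimension_face:
  assumes u: "u \<in> P"
  shows "affine_dimension (face u) = dim (tight_dir u)"
proof -
  let ?D = "{x - y | x y. x \<in> face u \<and> y \<in> face u}"
  have "x - y \<in> tight_dir u" if "x \<in> face u" "y \<in> face u" for x y
    using that diff_in_V[of y x] by (auto simp: tight_dir_def face_def tight_def L_diff subset_eq)
  then have "?D \<subseteq> span (tight_dir u)" using span_superset by blast
  moreover have "tight_dir u \<subseteq> span ?D"
  proof
    fix v assume "v \<in> tight_dir u"
    then obtain \<epsilon> where e: "\<epsilon> > 0" "u + \<epsilon> *\<^sub>R v \<in> face u" using push u by blast
    have "u \<in> face u" using u by (simp add: face_def)
    then have "(u + \<epsilon> *\<^sub>R v) - u \<in> ?D" using e by blast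
    then have "(1 / \<epsilon>) *\<^sub>R ((u + \<epsilon> *\<^sub>R v) - u) \<in> span ?D" by (intro span_scale span_base)
    then show "v \<in> span ?D" using e by simp
  qed
  ultimately have "span ?D = span (tight_dir u)" by (simp only: span_eq)
  then show ?thesis unfolding affine_dimension_def by (rule span_eq_dim)
qed

text \<open>Since \<open>dim\<close> is 0 on infinite-dimensional sets, monotonicity rests on the
  finite spanning set \<open>B\<close>.\<close>

lemma affine_dimension_face_le:
  assumes B: "finite B" "V \<subseteq> span B" and "F \<subseteq> P"
  shows "affine_dimension F \<le> affine_dimension P"
proof -
  let ?D = "\<lambda>S. {x - y | x y. x \<in> S \<and> y \<in> (S :: 'v set)}"
  obtain C where C: "C \<subseteq> ?D P" "independent C" "?D P \<subseteq> span C" "card C = dim (?D P)"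
    using basis_exists by blast
  have "C \<subseteq> span B" using C(1) B(2) diff_in_V by blast
  then have "finite C" using independent_span_bound[OF B(1) C(2)] by blast
  moreover have "?D F \<subseteq> span C" using C(3) \<open>F \<subseteq> P\<close> by blast
  ultimately show ?thesis
    unfolding affine_dimension_def C(4)[symmetric] by (intro dim_le_card)
qed

text \<open>Nonempty faces correspond to tight sets of points of \<open>P\<close>, so any
  \<open>sig\<close> that distinguishes exactly the tight sets indexes the faces, and the count by
  dimension becomes one sum over signatures.\<close>

lemma f_poly_eq_sum_signatures:
  fixes sig :: "'v \<Rightarrow> 'b"
  assumes B: "finite B" "V \<subseteq> span B"
    and sig: "\<And>u w. u \<in> P \<Longrightarrow> w \<in> P \<Longrightarrow> sig u = sig w \<longleftrightarrow> tight u = tight w"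
    and \<delta>: "\<And>u. u \<in> P \<Longrightarrow> dim (tight_dir u) = \<delta> (sig u)"
  shows "f_poly P = (\<Sum>w\<in>sig ` P. monom 1 (\<delta> w))"
proof -
  define Fs where "Fs = {F. F face_of P \<and> F \<noteq> {}}"
  have Fs: "Fs = face ` P"
  proof (intro equalityI subsetI)
    fix F assume "F \<in> Fs"
    then show "F \<in> face ` P" using face_of_imp_face unfolding Fs_def by blast
  next
    fix F assume "F \<in> face ` P"
    then obtain u where "u \<in> P" "F = face u" by blast
    moreover have "u \<in> face u" using \<open>u \<in> P\<close> by (simp add: face_def)
    ultimately show "F \<in> Fs" using face_face_of unfolding Fs_def by blast
  qed
  have face_eq: "face u = face w \<longleftrightarrow> sig u = sig w" if "u \<in> P" "w \<in> P" for u w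
  proof
    assume "face u = face w"
    moreover have "u \<in> face u" "w \<in> face w" using that by (simp_all add: face_def)
    ultimately have "u \<in> face w" "w \<in> face u" by simp_all
    then show "sig u = sig w" using sig[OF that] by (auto simp: face_def)
  next
    assume "sig u = sig w"
    then show "face u = face w" using sig[OF that] by (simp add: face_def)
  qed
  \<comment> \<open>A face depends only on a subset of the finite set \<open>A\<close>.\<close>
  have "finite (tight ` P)"
    by (rule finite_subset[of _ "Pow A"]) (auto simp: tight_def finA)
  moreover have "face ` P = (\<lambda>T. {w \<in> P. T \<subseteq> tight w}) ` tight ` P"
    by (auto simp: face_def image_image)
  ultimately have fin: "finite Fs" by (simp add: Fs)
  define rep where "rep = inv_into P sig"
  have rep: "rep x \<in> P" "sig (rep x) = x" if "x \<in> sig ` P" for x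
    using that by (simp_all add: rep_def inv_into_into f_inv_into_f)
  have bij: "bij_betw (\<lambda>x. face (rep x)) (sig ` P) Fs"
    unfolding bij_betw_def
  proof
    show "inj_on (\<lambda>x. face (rep x)) (sig ` P)"
      by (rule inj_onI) (metis face_eq rep)
    show "(\<lambda>x. face (rep x)) ` sig ` P = Fs"
    proof (intro equalityI subsetI)
      fix F assume "F \<in> Fs"
      then obtain u where u: "u \<in> P" "F = face u" unfolding Fs by blast
      then have "F = face (rep (sig u))" using face_eq rep[of "sig u"] by simp
      then show "F \<in> (\<lambda>x. face (rep x)) ` sig ` P" using u by blast
    qed (use rep in \<open>auto simp: Fs\<close>)
  qed
  have monom_card: "monom (int (card S)) d = (\<Sum>F\<in>S. monom 1 d)" for S :: "'v set set" and d
    by (simp add: of_nat_monom mult_monom)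
  have "f_poly P = (\<Sum>d\<le>affine_dimension P. \<Sum>F | F \<in> Fs \<and> affine_dimension F = d. monom 1 (affine_dimension F))"
    unfolding f_poly_def monom_card by (intro sum.cong) (auto simp: Fs_def)
  \<comment> \<open>No face is lost by stopping at the dimension of \<open>P\<close>.\<close>
  also have "\<dots> = (\<Sum>F\<in>Fs. monom 1 (affine_dimension F))"
  proof (rule sum.group[OF fin])
    show "affine_dimension ` Fs \<subseteq> {..affine_dimension P}"
      using affine_dimension_face_le[OF B] by (auto simp: Fs face_def)
  qed simp
  also have "\<dots> = (\<Sum>x\<in>sig ` P. monom 1 (affine_dimension (face (rep x))))"
    by (rule sum.reindex_bij_betw[OF bij, symmetric])
  also have "\<dots> = (\<Sum>x\<in>sig ` P. monom 1 (\<delta> x))"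
    by (intro sum.cong refl) (metis affine_dimension_face \<delta> rep)
  finally show ?thesis .
qed

end

section \<open>Words of tight inequalities\<close>

text \<open>A letter \<open>(yl, yt, xl, xy)\<close> records which of
  \<open>y\<^sub>i\<^sub>+\<^sub>1 = y\<^sub>i\<close>, \<open>y\<^sub>i\<^sub>+\<^sub>1 = 3\<close>, \<open>x\<^sub>i\<^sub>+\<^sub>1 = x\<^sub>i\<close>, \<open>x\<^sub>i\<^sub>+\<^sub>1 = y\<^sub>i\<^sub>+\<^sub>1\<close>
  hold; the state \<open>(e, t)\<close> records whether \<open>x\<^sub>i = y\<^sub>i\<close> and \<open>y\<^sub>i = 3\<close>.\<close>

type_synonym letter = "bool \<times> bool \<times> bool \<times> bool"

text \<open>An entry is at both ends of its interval exactly if the interval is a point. For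
  \<open>[y\<^sub>i, 3]\<close> this means \<open>t\<close>; for
  \<open>[x\<^sub>i, y\<^sub>i\<^sub>+\<^sub>1]\<close> it means \<open>e\<close> and
  \<open>yl\<close>. The next state is \<open>(xy, yt)\<close>.\<close>

fun admissible :: "bool \<Rightarrow> bool \<Rightarrow> letter list \<Rightarrow> bool" where
  "admissible e t [] \<longleftrightarrow> True"
| "admissible e t ((yl, yt, xl, xy) # w) \<longleftrightarrow>
     (if t then yl \<and> yt else \<not> (yl \<and> yt)) \<and>
     (if e \<and> yl then xl \<and> xy else \<not> (xl \<and> xy)) \<and> admissible xy yt w"

definition free_count :: "letter \<Rightarrow> nat" where
  "free_count = (\<lambda>(yl, yt, xl, xy). of_bool (\<not> yl \<and> \<not> yt) + of_bool (\<not> xl \<and> \<not> xy))"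

definition weight :: "letter list \<Rightarrow> nat" where
  "weight w = sum_list (map free_count w)"

definition words :: "nat \<Rightarrow> bool \<Rightarrow> bool \<Rightarrow> letter list set" where
  "words k e t = {w. length w = k \<and> admissible e t w}"

definition word_sum :: "'a::comm_ring_1 \<Rightarrow> nat \<Rightarrow> bool \<Rightarrow> bool \<Rightarrow> 'a" where
  "word_sum q k e t = (\<Sum>w\<in>words k e t. q ^ weight w)"

lemma finite_words: "finite (words k e t)"
  using finite_lists_length_eq[of "UNIV :: letter set" k] by (rule finite_subset[rotated]) (auto simp: words_def)

definition letters :: "bool \<Rightarrow> bool \<Rightarrow> letter set" where
  "letters e t = {b. admissible e t [b]}"

lemma admissible_Cons_iff:
  "admissible e t (b # w) \<longleftrightarrow> b \<in> letters e t \<and> admissible (snd (snd (snd b))) (fst (snd b)) w"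
  by (cases b) (auto simp: letters_def)

text \<open>Splitting off the first letter. The restriction to \<open>B\<close> serves the first
  step of the polytopes, where \<open>yl\<close> is forced; \<open>B = UNIV\<close> gives the plain
  recurrence.\<close>

lemma sum_words_Suc:
  "(\<Sum>w | w \<in> words (Suc k) e t \<and> hd w \<in> B. q ^ weight w) =
    (\<Sum>b\<in>letters e t \<inter> B. q ^ free_count b * word_sum q k (snd (snd (snd b))) (fst (snd b)))"
proof -
  let ?next = "\<lambda>b. words k (snd (snd (snd b))) (fst (snd b))"
  have eq: "{w. w \<in> words (Suc k) e t \<and> hd w \<in> B} = (\<lambda>(b, w). b # w) ` Sigma (letters e t \<inter> B) ?next"
  proof (intro equalityI subsetI)
    fix w assume "w \<in> {w. w \<in> words (Suc k) e t \<and> hd w \<in> B}"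
    then obtain b v where "w = b # v" "length v = k" "admissible e t (b # v)" "b \<in> B"
      by (auto simp: words_def length_Suc_conv)
    then show "w \<in> (\<lambda>(b, w). b # w) ` Sigma (letters e t \<inter> B) ?next"
      by (intro image_eqI[of _ _ "(b, v)"]) (auto simp: words_def admissible_Cons_iff)
  qed (auto simp: words_def admissible_Cons_iff)
  have inj: "inj_on (\<lambda>(b, w). b # w) (Sigma (letters e t \<inter> B) ?next)" by (auto simp: inj_on_def)
  have "(\<Sum>w | w \<in> words (Suc k) e t \<and> hd w \<in> B. q ^ weight w) =
      (\<Sum>(b, w)\<in>Sigma (letters e t \<inter> B) ?next. q ^ free_count b * q ^ weight w)"
    unfolding eq sum.reindex[OF inj] by (intro sum.cong) (auto simp: weight_def power_add)
  also have "\<dots> = (\<Sum>b\<in>letters e t \<inter> B. \<Sum>w\<in>?next b. q ^ free_count b * q ^ weight w)"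
    by (rule sum.Sigma[symmetric]) (auto simp: finite_words)
  finally show ?thesis
    by (simp add: word_sum_def sum_distrib_left)
qed

lemma word_sum_0: "word_sum q 0 e t = 1"
proof -
  have "words 0 e t = {[]}" by (auto simp: words_def)
  then show ?thesis by (simp add: word_sum_def weight_def)
qed

lemma word_sum_Suc:
  "word_sum q (Suc k) e t =
    (\<Sum>b\<in>letters e t. q ^ free_count b * word_sum q k (snd (snd (snd b))) (fst (snd b)))"
  using sum_words_Suc[where B = UNIV and q = q] by (simp add: word_sum_def)

lemma letters_simps:
  "letters True True = {(True, True, True, True)}"
  "letters False True =
    {(True, True, True, False), (True, True, False, True), (True, True, False, False)}"
  "letters True False =
    {(True, False, True, True),
     (False, True, True, False), (False, True, False, True), (False, True, False, False),
     (False, False, True, False), (False, False, False, True), (False, False, False, False)}"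
  "letters False False =
    {(True, False, True, False), (True, False, False, True), (True, False, False, False),
     (False, True, True, False), (False, True, False, True), (False, True, False, False),
     (False, False, True, False), (False, False, False, True), (False, False, False, False)}"
  by (simp_all add: letters_def set_eq_iff split_paired_All all_bool_eq)

definition chain :: "nat \<Rightarrow> (nat \<Rightarrow> real) \<Rightarrow> (nat \<Rightarrow> real) \<Rightarrow> bool" where
  "chain n X Y \<longleftrightarrow>
    (\<forall>i<n. Y i \<le> Y (Suc i) \<and> Y (Suc i) \<le> 3 \<and> X i \<le> X (Suc i) \<and> X (Suc i) \<le> Y (Suc i))"

definition letter_at :: "(nat \<Rightarrow> real) \<Rightarrow> (nat \<Rightarrow> real) \<Rightarrow> nat \<Rightarrow> letter" where
  "letter_at X Y i = (Y (Suc i) = Y i, Y (Suc i) = 3, X (Suc i) = X i, X (Suc i) = Y (Suc i))"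

lemma map_letter_at_Suc:
  "map (letter_at X Y) [0..<Suc n] =
    letter_at X Y 0 # map (letter_at (\<lambda>i. X (Suc i)) (\<lambda>i. Y (Suc i))) [0..<n]"
  by (simp add: upt_conv_Cons letter_at_def flip: map_Suc_upt del: upt_Suc)

lemma chain_Suc:
  "chain (Suc n) X Y \<longleftrightarrow> Y 0 \<le> Y 1 \<and> Y 1 \<le> 3 \<and> X 0 \<le> X 1 \<and> X 1 \<le> Y 1 \<and>
    chain n (\<lambda>i. X (Suc i)) (\<lambda>i. Y (Suc i))"
  by (auto simp: chain_def less_Suc_eq_0_disj)

lemma chain_admissible:
  assumes "X 0 \<le> Y 0" "Y 0 \<le> 3" "chain n X Y"
  shows "admissible (X 0 = Y 0) (Y 0 = 3) (map (letter_at X Y) [0..<n])"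
  using assms
proof (induction n arbitrary: X Y)
  case (Suc n)
  have "admissible (X 1 = Y 1) (Y 1 = 3) (map (letter_at (\<lambda>i. X (Suc i)) (\<lambda>i. Y (Suc i))) [0..<n])"
    using Suc.IH[of "\<lambda>i. X (Suc i)" "\<lambda>i. Y (Suc i)"] Suc.prems by (simp add: chain_Suc)
  moreover have "letter_at X Y 0 = (Y 1 = Y 0, Y 1 = 3, X 1 = X 0, X 1 = Y 1)"
    by (simp add: letter_at_def)
  ultimately show ?case
    using Suc.prems unfolding map_letter_at_Suc chain_Suc by auto
qed simp

text \<open>Build the chains step by step: an entry goes to the end prescribed by the letter, and a
  free entry to the midpoint of its interval, which admissibility makes nondegenerate.\<close>

lemma admissible_realizable:
  assumes "x \<le> y" "y \<le> 3" "admissible (x = y) (y = 3) w"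
  shows "\<exists>X Y. X 0 = x \<and> Y 0 = y \<and> chain (length w) X Y \<and> map (letter_at X Y) [0..<length w] = w"
  using assms
proof (induction w arbitrary: x y)
  case Nil
  show ?case by (rule exI[of _ "\<lambda>_. x"], rule exI[of _ "\<lambda>_. y"]) (simp add: chain_def)
next
  case (Cons b w)
  obtain yl yt xl xy where b: "b = (yl, yt, xl, xy)" by (cases b)
  define y' where "y' = (if yl then y else if yt then 3 else (y + 3) / 2)"
  define x' where "x' = (if xl then x else if xy then y' else (x + y') / 2)"
  have y': "y \<le> y'" "y' \<le> 3" "y' = y \<longleftrightarrow> yl" "y' = 3 \<longleftrightarrow> yt"
    using Cons.prems by (auto simp: b y'_def split: if_splits)
  \<comment> \<open>From \<open>x \<le> y \<le> y'\<close>, the interval of the new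
    \<open>x'\<close> collapses only if all three agree; this is the condition in
    \<open>admissible\<close>.\<close>
  have eq: "x = y' \<longleftrightarrow> x = y \<and> yl" using y' Cons.prems by auto
  have x': "x \<le> x'" "x' \<le> y'" "x' = x \<longleftrightarrow> xl" "x' = y' \<longleftrightarrow> xy"
    using Cons.prems y' eq by (auto simp: b x'_def split: if_splits)
  obtain X Y where XY: "X 0 = x'" "Y 0 = y'" "chain (length w) X Y"
      "map (letter_at X Y) [0..<length w] = w"
    using Cons.IH[of x' y'] Cons.prems x' y' by (auto simp: b)
  \<comment> \<open>The new start values are prepended to both sequences by
    \<open>case_nat\<close>.\<close>
  show ?case
    using XY x' y'
    by (intro exI[of "\<lambda>X. \<exists>Y. _ X Y" "case_nat x X"], intro exI[of _ "case_nat y Y"])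
      (simp add: map_letter_at_Suc chain_Suc b letter_at_def[of "case_nat x X" "case_nat y Y" 0] del: upt_Suc)
qed

section \<open>Transfer recurrences and their generating functions\<close>

text \<open>The letters are grouped by target state. The last two right-hand sides differ only by
  \<open>(q + 1) * word_sum q k False False\<close>, which makes the system easy to solve.\<close>

lemma word_sum_recurrences:
  fixes q :: "'a::comm_ring_1"
  shows "word_sum q (Suc k) True True = word_sum q k True True"
    and "word_sum q (Suc k) False True = (q + 1) * word_sum q k False True + word_sum q k True True"
    and "word_sum q (Suc k) True False =
      (q + 1) * word_sum q k True False + (q + 1) * q * word_sum q k False False +
      (q + 1) * word_sum q k False True + word_sum q k True True"
    and "word_sum q (Suc k) False False =
      (q + 1) * word_sum q k True False + (q + 1)^2 * word_sum q k False False +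
      (q + 1) * word_sum q k False True + word_sum q k True True"
  by (simp_all add: word_sum_Suc letters_simps free_count_def algebra_simps power2_eq_square)

lemma fps_eq_add_X_mult:
  fixes F G :: "'a::comm_ring_1 fps"
  assumes "fps_nth F 0 = c" "\<And>n. fps_nth F (Suc n) = fps_nth G n"
  shows "F = fps_const c + fps_X * G"
  by (rule fps_ext) (use assms in \<open>auto simp: gr0_conv_Suc\<close>)

text \<open>The system is solved upwards from the absorbing state: \<open>F\<close> and then
  \<open>T\<close> are geometric, \<open>E\<close> is a multiple of \<open>G\<close>, and
  eliminating \<open>E\<close> leaves one equation for \<open>G\<close> with a quadratic
  factor.\<close>

lemma word_sum_fps:
  fixes q :: "'a::comm_ring_1"
  defines "s \<equiv> fps_const (q + 1)" and "z \<equiv> fps_X"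
    and "E \<equiv> Abs_fps (\<lambda>k. word_sum q k True False)"
    and "G \<equiv> Abs_fps (\<lambda>k. word_sum q k False False)"
  shows "E * ((1 - z) * (s^2 * z^2 - (s^2 + s) * z + 1)) = 1"
    and "(s * G + E) * ((1 - z) * (1 - s * z) * (s^2 * z^2 - (s^2 + s) * z + 1)) = - s * z + s + 1"
proof -
  define T where "T = Abs_fps (\<lambda>k. word_sum q k False True)"
  define F where "F = Abs_fps (\<lambda>k. word_sum q k True True)"
  have F: "F = 1 + z * F"
    using fps_eq_add_X_mult[of F 1 F] unfolding z_def
    by (simp add: F_def word_sum_0 word_sum_recurrences)
  have T: "T = 1 + z * (s * T + F)"
    using fps_eq_add_X_mult[of T 1 "s * T + F"] unfolding z_def
    by (simp add: F_def T_def s_def word_sum_0 word_sum_recurrences)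
  define r where "r = fps_const q"
  have r: "r = s - 1" by (simp add: r_def s_def fps_eq_iff)
  have E: "E = 1 + z * (s * E + s * r * G + s * T + F)"
    using fps_eq_add_X_mult[of E 1 "s * E + s * r * G + s * T + F"] unfolding z_def
    by (simp add: F_def T_def s_def E_def G_def r_def word_sum_0 word_sum_recurrences)
  have G: "G = 1 + z * (s * E + s^2 * G + s * T + F)"
    using fps_eq_add_X_mult[of G 1 "s * E + s^2 * G + s * T + F"] unfolding z_def
    by (simp add: F_def T_def s_def E_def G_def word_sum_0 word_sum_recurrences)
  let ?D = "s^2 * z^2 - (s^2 + s) * z + 1"
  have F': "(1 - z) * F = 1"
    using arg_cong[OF F, of "\<lambda>x. x - z * F"] by (simp add: left_diff_distrib)
  have T': "(1 - s * z) * T = F"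
  proof -
    have "(1 - s * z) * T = T - z * (s * T)" by (simp add: algebra_simps)
    also have "\<dots> = 1 + z * (s * T + F) - z * (s * T)" using T by simp
    also have "\<dots> = F" using F by (simp add: algebra_simps)
    finally show ?thesis .
  qed
  \<comment> \<open>Only the \<open>G\<close> terms survive in the difference, with coefficient
    \<open>s * r - s^2 = - s\<close>.\<close>
  have EG: "E = (1 - s * z) * G"
  proof -
    have "E - G = 1 + z * (s * E + s * r * G + s * T + F) - (1 + z * (s * E + s^2 * G + s * T + F))"
      using E G by simp
    also have "\<dots> = - (s * z * G)" by (simp add: r algebra_simps power2_eq_square)
    finally show ?thesis by (simp add: algebra_simps)
  qed
  have GD: "G * ?D = T"
  proof -
    have "G * ?D = G - z * (s^2 * G) - z * (s * ((1 - s * z) * G))"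
      by (simp add: algebra_simps power2_eq_square)
    also have "\<dots> = G - z * (s^2 * G) - z * (s * E)" by (simp only: EG)
    also have "\<dots> = 1 + z * (s * E + s^2 * G + s * T + F) - z * (s^2 * G) - z * (s * E)"
      using G by simp
    also have "\<dots> = 1 + z * (s * T + F)" by (simp add: algebra_simps)
    finally show ?thesis using T by simp
  qed
  \<comment> \<open>The factor \<open>1 - s * z\<close> of \<open>E\<close> cancels that of the
    denominator of \<open>T\<close>.\<close>
  have "E * ((1 - z) * ?D) = (1 - z) * ((1 - s * z) * (G * ?D))"
    unfolding EG by (simp only: mult.commute mult.left_commute mult.assoc)
  then show 1: "E * ((1 - z) * ?D) = 1" by (simp only: GD T' F')
  have "(s * G + E) * ((1 - z) * (1 - s * z) * ?D) =
      s * ((1 - z) * ((1 - s * z) * (G * ?D))) + (1 - s * z) * (E * ((1 - z) * ?D))"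
    unfolding distrib_right by (simp only: mult.commute mult.left_commute mult.assoc)
  also have "\<dots> = - s * z + s + 1" by (simp only: GD T' F' 1) simp
  finally show "(s * G + E) * ((1 - z) * (1 - s * z) * ?D) = - s * z + s + 1" .
qed

section \<open>The polytopes as pairs of chains\<close>

text \<open>The value \<open>2\<close> is repeated at the positions 0 and 1 of the second chain, so that the choice of
  \<open>u\<^sub>1\<^sub>,\<^sub>1\<close> between \<open>l\<close> and 2 is an ordinary step whose letter has \<open>yl\<close>. With \<open>c = 0\<close>
  these are the linear parts of the coordinates.\<close>

definition gz_xs :: "real \<Rightarrow> (nat \<Rightarrow> nat \<Rightarrow> real) \<Rightarrow> nat \<Rightarrow> real" where
  "gz_xs c u i = (if i = 0 then c else u i 1)"

definition gz_ys :: "real \<Rightarrow> (nat \<Rightarrow> nat \<Rightarrow> real) \<Rightarrow> nat \<Rightarrow> real" where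
  "gz_ys c u i = (if i \<le> 1 then c else u (i - 1) 2)"

text \<open>The components \<open>m = 0, 1, 2, 3\<close> match the letter entries \<open>yl\<close>,
  \<open>yt\<close>, \<open>xl\<close>, \<open>xy\<close>. The bound \<open>c\<close> is 3 for
  points and 0 for directions.\<close>

definition slack :: "real \<Rightarrow> (nat \<Rightarrow> real) \<Rightarrow> (nat \<Rightarrow> real) \<Rightarrow> nat \<times> nat \<Rightarrow> real" where
  "slack c X Y = (\<lambda>(i, m).
    [Y (Suc i) - Y i, c - Y (Suc i), X (Suc i) - X i, Y (Suc i) - X (Suc i)] ! m)"

definition strip_coords :: "nat \<Rightarrow> (nat \<times> nat) set" where
  "strip_coords k = {(i, j) \<in> gz_index (k + 2). j \<le> 2}"

definition strip_dir :: "nat \<Rightarrow> (nat \<Rightarrow> nat \<Rightarrow> real) set" where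
  "strip_dir k = {v. \<forall>i j. (i, j) \<notin> strip_coords k \<longrightarrow> v i j = 0}"

text \<open>Translating \<open>strip_dir\<close> by this array gives the affine space in which all
  columns from the third on have their forced value.\<close>

definition strip_base :: "nat \<Rightarrow> nat \<Rightarrow> nat \<Rightarrow> real" where
  "strip_base k i j = (if (i, j) \<in> gz_index (k + 2) \<and> 3 \<le> j then 3 else 0)"

text \<open>One step per row of the array. Under \<open>gz_ys 2\<close>, step 0 has a constant
  second chain, so \<open>(0, 0)\<close> is always tight and \<open>(0, 1)\<close> never.\<close>

definition strip_constraints :: "nat \<Rightarrow> (nat \<times> nat) set" where
  "strip_constraints k = {..<Suc k} \<times> {0, 1, 2, 3}"

lemma strip_coords_iff:
  "(i, j) \<in> strip_coords k \<longleftrightarrow> j = 1 \<and> 1 \<le> i \<and> i \<le> Suc k \<or> j = 2 \<and> 1 \<le> i \<and> i \<le> k"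
  by (auto simp: strip_coords_def gz_index_def)

lemma finite_strip_coords: "finite (strip_coords k)"
  by (rule finite_subset[of _ "{..Suc k} \<times> {..2}"]) (auto simp: strip_coords_iff)

lemma slack_nonneg_iff_chain:
  "(\<forall>a\<in>strip_constraints k. 0 \<le> slack 3 X Y a) \<longleftrightarrow> chain (Suc k) X Y"
  by (auto simp: strip_constraints_def slack_def chain_def)

lemma slack_zero_iff:
  "slack c X Y (i, 0) = 0 \<longleftrightarrow> Y (Suc i) = Y i"
  "slack c X Y (i, 1) = 0 \<longleftrightarrow> Y (Suc i) = c"
  "slack c X Y (i, 2) = 0 \<longleftrightarrow> X (Suc i) = X i"
  "slack c X Y (i, 3) = 0 \<longleftrightarrow> X (Suc i) = Y (Suc i)"
  by (auto simp: slack_def)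

text \<open>Row by row, both bounds of such an entry lie in columns from the third on of the
  previous row, hence equal 3.\<close>

lemma GZ_entry_eq_3:
  assumes u: "u \<in> GZ (l # 2 # replicate k 3)"
  shows "(i, j) \<in> gz_index (k + 2) \<Longrightarrow> 3 \<le> j \<Longrightarrow> u i j = 3"
proof (induction i arbitrary: j)
  case (Suc i)
  have bounds: "gz_entry (l # 2 # replicate k 3) u i j \<le> u (Suc i) j"
    "u (Suc i) j \<le> gz_entry (l # 2 # replicate k 3) u i (j + 1)"
    using u Suc.prems by (auto simp: GZ_def)
  have "gz_entry (l # 2 # replicate k 3) u i j' = 3" if "j' = j \<or> j' = j + 1" for j'
  proof (cases i)
    case 0
    then have "3 \<le> j'" "j' \<le> k + 2" using Suc.prems that by (auto simp: gz_index_def)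
    then show ?thesis using 0 by (simp add: gz_entry_def nth_Cons')
  next
    case (Suc m)
    then show ?thesis
      using Suc.prems that Suc.IH[of j'] by (auto simp: gz_entry_def gz_index_def)
  qed
  then show ?case using bounds by fastforce
qed (simp add: gz_index_def)

text \<open>Inequalities in column 1 are the steps of the first chain, those in column 2 the steps
  of the second with upper end 3, and those further right are trivial once the entries are
  3.\<close>

lemma mem_GZ_iff:
  "u \<in> GZ (l # 2 # replicate k 3) \<longleftrightarrow>
    u - strip_base k \<in> strip_dir k \<and> chain (Suc k) (gz_xs l u) (gz_ys 2 u)"
  (is "?L \<longleftrightarrow> ?R")
proof -
  let ?e = "gz_entry (l # 2 # replicate k 3) u"
  have e0: "?e 0 1 = l" "?e 0 2 = 2" by (simp_all add: gz_entry_def)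
  have eS: "?e (Suc i) j = u (Suc i) j" for i j by (simp add: gz_entry_def)
  have e3: "?e 0 j = 3" if "3 \<le> j" "j \<le> k + 2" for j
    using that by (simp add: gz_entry_def nth_Cons')
  have xs: "gz_xs l u i = ?e i 1" for i by (cases i) (auto simp: gz_xs_def gz_entry_def)
  have ys: "gz_ys 2 u (Suc i) = ?e i 2" for i by (cases i) (auto simp: gz_ys_def gz_entry_def)
  have ys0: "gz_ys 2 u 0 = 2" by (simp add: gz_ys_def)
  show ?thesis
  proof
    assume L: ?L
    have bounds: "?e i j \<le> ?e (Suc i) j" "?e (Suc i) j \<le> ?e i (Suc j)"
      if "(Suc i, j) \<in> gz_index (k + 2)" for i j
      using L that by (auto simp: GZ_def eS)
    have "u i j = 0" if "(i, j) \<notin> gz_index (k + 2)" for i j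
      using L that by (auto simp: GZ_def)
    then have "u - strip_base k \<in> strip_dir k"
      using GZ_entry_eq_3[OF L] by (auto simp: strip_dir_def strip_base_def strip_coords_def)
    moreover have "chain (Suc k) (gz_xs l u) (gz_ys 2 u)"
      unfolding chain_def
    proof (intro allI impI)
      fix i assume i: "i < Suc k"
      have "gz_ys 2 u i \<le> gz_ys 2 u (Suc i) \<and> gz_ys 2 u (Suc i) \<le> 3"
      proof (cases i)
        case 0
        then show ?thesis by (simp add: gz_ys_def)
      next
        case (Suc m)
        have "?e m 3 = 3"
          using GZ_entry_eq_3[OF L, of m 3] e3[of 3] Suc i
          by (cases m) (auto simp: eS gz_index_def)
        then show ?thesis
          using bounds[of m 2] Suc i by (auto simp: ys gz_index_def numeral_3_eq_3)
      qed
      moreover have "(Suc i, 1) \<in> gz_index (k + 2)" using i by (auto simp: gz_index_def)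
      ultimately show "gz_ys 2 u i \<le> gz_ys 2 u (Suc i) \<and> gz_ys 2 u (Suc i) \<le> 3 \<and>
          gz_xs l u i \<le> gz_xs l u (Suc i) \<and> gz_xs l u (Suc i) \<le> gz_ys 2 u (Suc i)"
        using bounds[of i 1] by (auto simp: xs ys numeral_2_eq_2)
    qed
    ultimately show ?R by blast
  next
    assume R: ?R
    then have ch: "chain (Suc k) (gz_xs l u) (gz_ys 2 u)" by blast
    have rest: "u i j = strip_base k i j" if "(i, j) \<notin> strip_coords k" for i j
      using R that by (auto simp: strip_dir_def)
    have "?e i j \<le> ?e (Suc i) j \<and> ?e (Suc i) j \<le> ?e i (Suc j)"
      if "(Suc i, j) \<in> gz_index (k + 2)" for i j
    proof -
      consider "j = 1" | "j = 2" | "3 \<le> j" using \<open>(Suc i, j) \<in> gz_index (k + 2)\<close> by (force simp: gz_index_def)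
      then show ?thesis
      proof cases
        case 1
        then have "i < Suc k" using that by (auto simp: gz_index_def)
        then show ?thesis using ch 1 unfolding chain_def xs ys by (auto simp: numeral_2_eq_2)
      next
        case 2
        \<comment> \<open>The repeated 2 shifts the second chain: row \<open>Suc i\<close> of column
          2 is reached by step \<open>Suc i\<close>, not \<open>i\<close>.\<close>
        then have i: "Suc i < Suc k" using that by (auto simp: gz_index_def)
        have "?e i 3 = 3"
          using e3[of 3] rest[of i 3] i by (cases i) (auto simp: eS strip_coords_iff strip_base_def gz_index_def)
        then show ?thesis using ch 2 i unfolding chain_def by (auto simp: ys numeral_3_eq_3)
      next
        case 3
        have "?e i' j' = 3" if "i' = Suc i \<and> j' = j \<or> i' = i \<and> (j' = j \<or> j' = Suc j)" for i' j'
          using e3[of j'] rest[of i' j'] \<open>(Suc i, j) \<in> gz_index (k + 2)\<close> 3 that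
          by (cases i') (auto simp: eS strip_coords_iff strip_base_def gz_index_def)
        then show ?thesis by simp
      qed
    qed
    then have "?e (i - 1) j \<le> u i j \<and> u i j \<le> ?e (i - 1) (j + 1)" if "(i, j) \<in> gz_index (k + 2)" for i j
      using that by (cases i) (auto simp: eS gz_index_def)
    moreover have "u i j = 0" if "(i, j) \<notin> gz_index (k + 2)" for i j
      using rest[of i j] that by (auto simp: strip_coords_def strip_base_def)
    ultimately show ?L by (auto simp: GZ_def)
  qed
qed

text \<open>Replacing the constants \<open>l\<close>, 2 and 3 by 0 turns each slack into its linear
  part.\<close>

global_interpretation strip: polyhedron_presentation "strip_dir k" "strip_base k" "strip_constraints k"
    "\<lambda>a u. slack 3 (gz_xs l u) (gz_ys 2 u) a" "\<lambda>a v. slack 0 (gz_xs 0 v) (gz_ys 0 v) a"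
  for k :: nat and l :: real
proof (rule polyhedron_presentation.intro)
  show "subspace (strip_dir k)" by (auto simp: subspace_def strip_dir_def)
  show "finite (strip_constraints k)" by (simp add: strip_constraints_def)
  show "linear (\<lambda>v. slack 0 (gz_xs 0 v) (gz_ys 0 v) a)" if "a \<in> strip_constraints k" for a
    using that by (intro linearI) (auto simp: strip_constraints_def slack_def gz_xs_def gz_ys_def algebra_simps)
  show "slack 3 (gz_xs l (u + c *\<^sub>R v)) (gz_ys 2 (u + c *\<^sub>R v)) a =
      slack 3 (gz_xs l u) (gz_ys 2 u) a + c * slack 0 (gz_xs 0 v) (gz_ys 0 v) a"
    if "a \<in> strip_constraints k" for a u c v
    using that by (auto simp: strip_constraints_def slack_def gz_xs_def gz_ys_def algebra_simps)
qed

lemma strip_P_eq_GZ: "strip.P k l = GZ (l # 2 # replicate k 3)"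
  by (auto simp: strip.P_def slack_nonneg_iff_chain mem_GZ_iff)

definition strip_sig :: "nat \<Rightarrow> real \<Rightarrow> (nat \<Rightarrow> nat \<Rightarrow> real) \<Rightarrow> letter list" where
  "strip_sig k l u = map (letter_at (gz_xs l u) (gz_ys 2 u)) [0..<Suc k]"

lemma strip_sig_eq_iff: "strip_sig k l u = strip_sig k l w \<longleftrightarrow> strip.tight k l u = strip.tight k l w"
proof -
  have tight: "strip.tight k l u = strip.tight k l w \<longleftrightarrow>
      (\<forall>i<Suc k. \<forall>m\<in>{0, 1, 2, 3}. slack 3 (gz_xs l u) (gz_ys 2 u) (i, m) = 0 \<longleftrightarrow>
         slack 3 (gz_xs l w) (gz_ys 2 w) (i, m) = 0)"
    unfolding strip.tight_def by (auto simp: strip_constraints_def set_eq_iff simp del: One_nat_def)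
  have "strip_sig k l u = strip_sig k l w \<longleftrightarrow>
      (\<forall>i<Suc k. letter_at (gz_xs l u) (gz_ys 2 u) i = letter_at (gz_xs l w) (gz_ys 2 w) i)"
    unfolding strip_sig_def by (auto simp del: upt_Suc)
  then show ?thesis
    unfolding tight by (simp only: slack_zero_iff ball_simps letter_at_def prod.inject simp_thms)
qed

text \<open>The automaton starts at \<open>x\<^sub>0 = l\<close>, \<open>y\<^sub>0 = 2\<close>, and
  the repeated 2 forces \<open>yl\<close> in the first letter. Conversely, an admissible word is
  realized by chains, which are written back into the array.\<close>

lemma strip_sig_image:
  assumes "l \<le> 2"
  shows "strip_sig k l ` GZ (l # 2 # replicate k 3) = {w \<in> words (Suc k) (l = 2) False. hd w \<in> {b. fst b}}"
proof (intro equalityI subsetI)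
  fix w assume "w \<in> strip_sig k l ` GZ (l # 2 # replicate k 3)"
  then obtain u where w: "w = strip_sig k l u" and "chain (Suc k) (gz_xs l u) (gz_ys 2 u)"
    by (auto simp: mem_GZ_iff)
  then show "w \<in> {w \<in> words (Suc k) (l = 2) False. hd w \<in> {b. fst b}}"
    using chain_admissible[of "gz_xs l u" "gz_ys 2 u" "Suc k"] assms
    by (auto simp: words_def strip_sig_def gz_xs_def gz_ys_def letter_at_def hd_map simp del: upt_Suc)
next
  fix w assume w: "w \<in> {w \<in> words (Suc k) (l = 2) False. hd w \<in> {b. fst b}}"
  then obtain X Y where XY: "X 0 = l" "Y 0 = 2" "chain (Suc k) X Y" "map (letter_at X Y) [0..<Suc k] = w"
    using admissible_realizable[of l 2 w] assms by (auto simp: words_def)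
  \<comment> \<open>Needed because \<open>gz_ys\<close> returns the constant 2 at position 1,
    whatever the array.\<close>
  then have Y1: "Y 1 = 2" using w by (auto simp: map_letter_at_Suc letter_at_def simp del: upt_Suc)
  define u where "u i j = (if (i, j) \<notin> strip_coords k then strip_base k i j
     else if j = 1 then X i else Y (Suc i))" for i j
  have X: "gz_xs l u i = X i" if "i \<le> Suc k" for i
    using that XY by (auto simp: gz_xs_def u_def strip_coords_iff)
  have Y: "gz_ys 2 u i = Y i" if "i \<le> Suc k" for i
    using that XY Y1 by (cases "i = 0 \<or> i = 1") (auto simp: gz_ys_def u_def strip_coords_iff)
  have "u - strip_base k \<in> strip_dir k" by (auto simp: strip_dir_def u_def)
  moreover have "chain (Suc k) (gz_xs l u) (gz_ys 2 u)"
    using XY(3) by (auto simp: chain_def X Y)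
  moreover have "strip_sig k l u = w"
    unfolding XY(4)[symmetric] strip_sig_def by (auto simp: letter_at_def X Y simp del: upt_Suc)
  ultimately show "w \<in> strip_sig k l ` GZ (l # 2 # replicate k 3)"
    using mem_GZ_iff by blast
qed

section \<open>Dimension of a face from its word\<close>

lemma mem_strip_tight_dir:
  fixes u :: "nat \<Rightarrow> nat \<Rightarrow> real" and l :: real
  defines "X \<equiv> gz_xs l u" and "Y \<equiv> gz_ys 2 u"
  shows "v \<in> strip.tight_dir k l u \<longleftrightarrow> v \<in> strip_dir k \<and>
    (\<forall>i<Suc k. (Y (Suc i) = Y i \<longrightarrow> gz_ys 0 v (Suc i) = gz_ys 0 v i) \<and>
      (Y (Suc i) = 3 \<longrightarrow> gz_ys 0 v (Suc i) = 0) \<and>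
      (X (Suc i) = X i \<longrightarrow> gz_xs 0 v (Suc i) = gz_xs 0 v i) \<and>
      (X (Suc i) = Y (Suc i) \<longrightarrow> gz_xs 0 v (Suc i) = gz_ys 0 v (Suc i)))"
proof -
  have "v \<in> strip.tight_dir k l u \<longleftrightarrow> v \<in> strip_dir k \<and>
      (\<forall>i<Suc k. \<forall>m\<in>{0, 1, 2, 3}. slack 3 X Y (i, m) = 0 \<longrightarrow>
         slack 0 (gz_xs 0 v) (gz_ys 0 v) (i, m) = 0)"
    unfolding strip.tight_dir_def strip.tight_def X_def Y_def
    by (auto simp: strip_constraints_def simp del: One_nat_def)
  then show ?thesis by (simp only: ball_simps slack_zero_iff simp_thms)
qed

lemma weight_letter_at:
  "weight (map (letter_at X Y) [0..<n]) =
    card {i. i < n \<and> X (Suc i) \<noteq> X i \<and> X (Suc i) \<noteq> Y (Suc i)} +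
    card {i. i < n \<and> Y (Suc i) \<noteq> Y i \<and> Y (Suc i) \<noteq> 3}"
proof -
  have "weight (map (letter_at X Y) [0..<n]) = (\<Sum>i\<in>{0..<n}. free_count (letter_at X Y i))"
    unfolding weight_def map_map comp_def interv_sum_list_conv_sum_set_nat by simp
  also have "\<dots> = card ({0..<n} \<inter> {i. Y (Suc i) \<noteq> Y i \<and> Y (Suc i) \<noteq> 3}) +
      card ({0..<n} \<inter> {i. X (Suc i) \<noteq> X i \<and> X (Suc i) \<noteq> Y (Suc i)})"
    by (simp add: free_count_def letter_at_def sum.distrib flip: of_bool_conj)
  also have "{0..<n} \<inter> {i. Y (Suc i) \<noteq> Y i \<and> Y (Suc i) \<noteq> 3} =
      {i. i < n \<and> Y (Suc i) \<noteq> Y i \<and> Y (Suc i) \<noteq> 3}" by auto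
  also have "{0..<n} \<inter> {i. X (Suc i) \<noteq> X i \<and> X (Suc i) \<noteq> Y (Suc i)} =
      {i. i < n \<and> X (Suc i) \<noteq> X i \<and> X (Suc i) \<noteq> Y (Suc i)}" by auto
  finally show ?thesis by simp
qed

text \<open>The free entries are coordinates of the direction space: their values can be prescribed,
  and the tight equations determine all others successively along the chains.\<close>

lemma dim_strip_tight_dir:
  assumes u: "u \<in> GZ (l # 2 # replicate k 3)" and l: "l \<le> 2"
  shows "dim (strip.tight_dir k l u) = weight (strip_sig k l u)"
proof -
  define X Y where "X = gz_xs l u" and "Y = gz_ys 2 u"
  have ch: "chain (Suc k) X Y" using u by (simp add: mem_GZ_iff X_def Y_def)
  have Y01: "Y 0 = 2" "Y 1 = 2" and X0: "X 0 = l" by (simp_all add: Y_def X_def gz_ys_def gz_xs_def)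
  have le: "X i \<le> Y i \<and> Y i \<le> 3" if "i \<le> Suc k" for i
    using that ch l Y01 X0 by (cases i) (auto simp: chain_def)
  define A where "A = {i. i < Suc k \<and> X (Suc i) \<noteq> X i \<and> X (Suc i) \<noteq> Y (Suc i)}"
  define B where "B = {i. i < Suc k \<and> Y (Suc i) \<noteq> Y i \<and> Y (Suc i) \<noteq> 3}"
  \<comment> \<open>An index \<open>i\<close> refers to the entries reached by step
    \<open>i\<close>: \<open>X (Suc i)\<close> sits in row \<open>Suc i\<close> of column 1, but
    \<open>Y (Suc i)\<close> in row \<open>i\<close> of column 2.\<close>
  define S where "S = (\<lambda>i. (Suc i, 1 :: nat)) ` A \<union> (\<lambda>i. (i, 2 :: nat)) ` B"
  have fin: "finite A" "finite B" by (simp_all add: A_def B_def)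
  have "card S = card A + card B"
    unfolding S_def using fin by (subst card_Un_disjoint) (auto simp: card_image inj_on_def)
  then have weight: "weight (strip_sig k l u) = card S"
    by (simp only: strip_sig_def weight_letter_at A_def B_def X_def Y_def)
  have mem: "v \<in> strip.tight_dir k l u \<longleftrightarrow> v \<in> strip_dir k \<and>
      (\<forall>i<Suc k. (Y (Suc i) = Y i \<longrightarrow> gz_ys 0 v (Suc i) = gz_ys 0 v i) \<and>
      (Y (Suc i) = 3 \<longrightarrow> gz_ys 0 v (Suc i) = 0) \<and>
      (X (Suc i) = X i \<longrightarrow> gz_xs 0 v (Suc i) = gz_xs 0 v i) \<and>
      (X (Suc i) = Y (Suc i) \<longrightarrow> gz_xs 0 v (Suc i) = gz_ys 0 v (Suc i)))" for v
    unfolding X_def Y_def by (rule mem_strip_tight_dir)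
  show ?thesis
    unfolding weight
  proof (rule coordinate_basis[of "strip.tight_dir k l u" S "\<lambda>(i, j) v. v i j"])
    show "subspace (strip.tight_dir k l u)"
      by (rule strip.subspace_tight_dir)
    show "finite S" using fin by (simp add: S_def)
    show "linear (case c of (i, j) \<Rightarrow> \<lambda>v. v i j)" for c :: "nat \<times> nat"
      by (cases c) (auto intro!: linearI)
  next
    fix v :: "nat \<Rightarrow> nat \<Rightarrow> real"
    assume v: "v \<in> strip.tight_dir k l u"
      and S0: "\<And>c. c \<in> S \<Longrightarrow> (case c of (i, j) \<Rightarrow> \<lambda>v. v i j) v = 0"
    have SX: "v (Suc i) 1 = 0" if "i \<in> A" for i using S0[of "(Suc i, 1)"] that by (auto simp: S_def)
    have SY: "v i 2 = 0" if "i \<in> B" for i using S0[of "(i, 2)"] that by (auto simp: S_def)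
    \<comment> \<open>Each entry is either free, hence zero by assumption, or equal to an end of its
      interval that is already known to vanish.\<close>
    have "gz_xs 0 v i = 0 \<and> gz_ys 0 v i = 0" if "i \<le> Suc k" for i
      using that
    proof (induction i)
      case (Suc i)
      then have IH: "gz_xs 0 v i = 0" "gz_ys 0 v i = 0" and i: "i < Suc k" by auto
      have "gz_ys 0 v (Suc i) = 0"
        using v IH i SY[of i] unfolding mem by (cases "i \<in> B") (auto simp: B_def gz_ys_def)
      then show ?case
        using v IH i SX[of i] unfolding mem by (cases "i \<in> A") (auto simp: A_def gz_xs_def)
    qed (simp add: gz_xs_def gz_ys_def)
    then have zero: "gz_xs 0 v i = 0" "gz_ys 0 v i = 0" if "i \<le> Suc k" for i using that by auto
    have "v i j = 0" for i j
    proof (cases "(i, j) \<in> strip_coords k")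
      case True
      then consider "j = 1" "1 \<le> i" "i \<le> Suc k" | "j = 2" "1 \<le> i" "i \<le> k"
        unfolding strip_coords_iff by blast
      then show ?thesis
        using zero(1)[of i] zero(2)[of "Suc i"] by cases (auto simp: gz_xs_def gz_ys_def)
    qed (use v mem in \<open>unfold strip_dir_def, blast\<close>)
    then show "v = 0" by (simp add: fun_eq_iff)
  next
    fix h :: "nat \<times> nat \<Rightarrow> real"
    \<comment> \<open>A free entry takes its prescribed value, any other copies an end of its
      interval, the lower one if both apply.\<close>
    define VY where "VY = rec_nat 0 (\<lambda>i y. if Y (Suc i) = Y i then y else if Y (Suc i) = 3 then 0 else h (i, 2))"
    define VX where "VX = rec_nat 0 (\<lambda>i x. if X (Suc i) = X i then x else if X (Suc i) = Y (Suc i) then VY (Suc i) else h (Suc i, 1))"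
    have VY: "VY 0 = 0" "VY (Suc i) = (if Y (Suc i) = Y i then VY i else if Y (Suc i) = 3 then 0 else h (i, 2))" for i
      by (simp_all add: VY_def)
    have VX: "VX 0 = 0" "VX (Suc i) = (if X (Suc i) = X i then VX i else if X (Suc i) = Y (Suc i) then VY (Suc i) else h (Suc i, 1))" for i
      by (simp_all add: VX_def)
    have inv: "(Y i = 3 \<longrightarrow> VY i = 0) \<and> (X i = Y i \<longrightarrow> VX i = VY i)" if "i \<le> Suc k" for i
      using that
    proof (induction i)
      case (Suc i)
      then have IH: "Y i = 3 \<longrightarrow> VY i = 0" "X i = Y i \<longrightarrow> VX i = VY i" by auto
      have "Y i \<le> Y (Suc i)" using ch Suc.prems by (auto simp: chain_def)
      then have merge: "X i = Y i \<and> Y (Suc i) = Y i" if "X (Suc i) = Y (Suc i)" "X (Suc i) = X i"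
        using that le[of i] Suc.prems by auto
      \<comment> \<open>An entry at both ends of its interval imposes two equations; they agree because its ends
        were already identified at the previous step.\<close>
      have "VY (Suc i) = 0" if "Y (Suc i) = 3"
        using that IH(1) by (cases "Y (Suc i) = Y i") (simp_all add: VY(2))
      moreover have "VX (Suc i) = VY (Suc i)" if "X (Suc i) = Y (Suc i)"
        using that IH(2) merge by (cases "X (Suc i) = X i") (simp_all add: VX(2) VY(2))
      ultimately show ?case by blast
    qed (simp add: VX VY)
    define v where "v i j = (if (i, j) \<notin> strip_coords k then 0 else if j = 1 then VX i else VY (Suc i))" for i j
    have xs: "gz_xs 0 v i = VX i" if "i \<le> Suc k" for i
      using that by (auto simp: gz_xs_def v_def strip_coords_iff VX)
    have "VY (Suc 0) = 0" using VY Y01 by simp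
    then have ys: "gz_ys 0 v i = VY i" if "i \<le> Suc k" for i
      using that by (cases "i = 0 \<or> i = 1") (auto simp: gz_ys_def v_def strip_coords_iff VY)
    have "v \<in> strip.tight_dir k l u"
      unfolding mem
    proof (intro conjI allI impI)
      show "v \<in> strip_dir k" by (simp add: strip_dir_def v_def)
    next
      fix i assume i: "i < Suc k"
      then have seqs: "gz_xs 0 v i = VX i" "gz_ys 0 v i = VY i"
        "gz_xs 0 v (Suc i) = VX (Suc i)" "gz_ys 0 v (Suc i) = VY (Suc i)"
        by (simp_all add: xs ys)
      show "gz_ys 0 v (Suc i) = gz_ys 0 v i" if "Y (Suc i) = Y i"
        using that by (simp add: seqs VY(2))
      show "gz_xs 0 v (Suc i) = gz_xs 0 v i" if "X (Suc i) = X i"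
        using that by (simp add: seqs VX(2))
      show "gz_ys 0 v (Suc i) = 0" if "Y (Suc i) = 3"
        using that inv[of "Suc i"] i unfolding seqs by simp
      show "gz_xs 0 v (Suc i) = gz_ys 0 v (Suc i)" if "X (Suc i) = Y (Suc i)"
        using that inv[of "Suc i"] i unfolding seqs by simp
    qed
    moreover have "v i j = h (i, j)" if ij: "(i, j) \<in> S" for i j
    proof -
      consider i' where "i = Suc i'" "j = 1" "i' \<in> A" | "j = 2" "i \<in> B"
        using ij unfolding S_def by blast
      then show ?thesis
      proof cases
        case 1
        then show ?thesis by (auto simp: v_def strip_coords_iff A_def VX(2))
      next
        case 2
        then have "Y (Suc i) \<noteq> Y i" by (simp add: B_def)
        \<comment> \<open>Step 0 of the second chain is constant, so a free entry there is a genuine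
          array coordinate.\<close>
        then have "i \<noteq> 0" using Y01 by (cases i) auto
        then show ?thesis using 2 by (auto simp: v_def strip_coords_iff B_def VY(2))
      qed
    qed
    ultimately show "\<exists>v\<in>strip.tight_dir k l u. \<forall>c\<in>S. (case c of (i, j) \<Rightarrow> \<lambda>v. v i j) v = h c"
      by (intro bexI[of _ v]) auto
  qed
qed

text \<open>Supplies the finite spanning set that bounds the dimensions of faces.\<close>

lemma strip_dir_finite_span: obtains B where "finite B" "strip_dir k \<subseteq> span B"
proof (rule coordinate_basis[of "strip_dir k" "strip_coords k" "\<lambda>(i, j) v. v i j"])
  show "subspace (strip_dir k)" by (auto simp: subspace_def strip_dir_def)
  show "linear (case c of (i, j) \<Rightarrow> \<lambda>v. v i j)" for c :: "nat \<times> nat"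
    by (cases c) (auto intro!: linearI)
  show "v = 0" if "v \<in> strip_dir k"
    "\<And>c. c \<in> strip_coords k \<Longrightarrow> (case c of (i, j) \<Rightarrow> \<lambda>v. v i j) v = 0"
    for v :: "nat \<Rightarrow> nat \<Rightarrow> real"
  proof (intro ext)
    fix i j
    show "v i j = 0 i j"
      using that(1) that(2)[of "(i, j)"] by (cases "(i, j) \<in> strip_coords k") (auto simp: strip_dir_def)
  qed
  show "\<exists>v\<in>strip_dir k. \<forall>c\<in>strip_coords k. (case c of (i, j) \<Rightarrow> \<lambda>v. v i j) v = h c" for h :: "nat \<times> nat \<Rightarrow> real"
    by (rule bexI[of _ "\<lambda>i j. if (i, j) \<in> strip_coords k then h (i, j) else 0"]) (auto simp: strip_dir_def)
qed (use finite_strip_coords in auto)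

section \<open>The h-polynomials and their generating series\<close>

lemma pcompose_monom_1: "pcompose (monom 1 n) p = p ^ n" for p :: "'a::comm_ring_1 poly"
  by (induction n) (simp_all add: monom_Suc pcompose_pCons monom_0)

text \<open>Words index the faces and their weights are the dimensions; the substitution
  \<open>t = s - 1\<close> turns each monomial into a power of \<open>[:-1, 1:]\<close>.\<close>

lemma h_poly_GZ:
  assumes "l \<le> 2"
  shows "h_poly (GZ (l # 2 # replicate k 3)) =
    (\<Sum>w | w \<in> words (Suc k) (l = 2) False \<and> hd w \<in> {b. fst b}. [:-1, 1:] ^ weight w)"
proof -
  obtain B where "finite B" "strip_dir k \<subseteq> span B" by (rule strip_dir_finite_span)
  then have "f_poly (GZ (l # 2 # replicate k 3)) =
      (\<Sum>w\<in>strip_sig k l ` GZ (l # 2 # replicate k 3). monom 1 (weight w))"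
    using strip.f_poly_eq_sum_signatures[of B k l "strip_sig k l" weight] assms
    by (simp add: strip_P_eq_GZ strip_sig_eq_iff dim_strip_tight_dir)
  then show ?thesis
    using assms by (simp add: strip_sig_image h_poly_def pcompose_sum pcompose_monom_1)
qed

text \<open>The first letter has \<open>yl\<close>. For \<open>l = 2\<close> it is unique, of weight
  0, and keeps the state. For \<open>l < 2\<close> the entry
  \<open>u\<^sub>1\<^sub>,\<^sub>1\<close> is at \<open>l\<close>, at 2 or free, contributing
  \<open>1 + q = s\<close> to the state \<open>(False, False)\<close> and 1 to
  \<open>(True, False)\<close>.\<close>

lemma h_poly_GZ_eq_word_sum:
  "h_poly (GZ (2 # 2 # replicate k 3)) = word_sum [:-1, 1:] k True False"
  "l < 2 \<Longrightarrow> h_poly (GZ (l # 2 # replicate k 3)) =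
    [:0, 1:] * word_sum [:-1, 1:] k False False + word_sum [:-1, 1:] k True False"
proof -
  have "letters True False \<inter> {b. fst b} = {(True, False, True, True)}"
    by (auto simp: letters_simps)
  then show "h_poly (GZ (2 # 2 # replicate k 3)) = word_sum [:-1, 1:] k True False"
    by (simp only: h_poly_GZ order_refl sum_words_Suc simp_thms) (simp add: free_count_def)
  have "letters False False \<inter> {b. fst b} =
      {(True, False, True, False), (True, False, False, True), (True, False, False, False)}"
    by (auto simp: letters_simps)
  then have "h_poly (GZ (l # 2 # replicate k 3)) =
      ([:-1, 1:] + 1) * word_sum [:-1, 1:] k False False + word_sum [:-1, 1:] k True False" if "l < 2"
    using that
    by (simp only: h_poly_GZ less_imp_le less_imp_neq sum_words_Suc simp_thms)
      (simp add: free_count_def algebra_simps)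
  then show "l < 2 \<Longrightarrow> h_poly (GZ (l # 2 # replicate k 3)) =
    [:0, 1:] * word_sum [:-1, 1:] k False False + word_sum [:-1, 1:] k True False"
    by (simp add: one_pCons)
qed

theorem mainTheorem4:
  shows "let s = fps_const [:0, 1:] :: int poly fps; z = fps_X :: int poly fps in
    Abs_fps (\<lambda>k. h_poly (GZ ([1, 2] @ replicate k 3))) =
      fps_quotient (- s * z + s + 1)
        ((1 - z) * (1 - s * z) * (s^2 * z^2 - (s^2 + s) * z + 1)) \<and>
    Abs_fps (\<lambda>k. h_poly (GZ ([2, 2] @ replicate k 3))) =
      fps_quotient 1
        ((1 - z) * (s^2 * z^2 - (s^2 + s) * z + 1))"
proof -
  define s z where "s = (fps_const [:0, 1:] :: int poly fps)" and "z = (fps_X :: int poly fps)"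
  define E where "E = Abs_fps (\<lambda>k. word_sum ([:-1, 1:] :: int poly) k True False)"
  define G where "G = Abs_fps (\<lambda>k. word_sum ([:-1, 1:] :: int poly) k False False)"
  have s: "s = fps_const ([:-1, 1:] + 1)" by (simp add: s_def one_pCons)
  have A: "Abs_fps (\<lambda>k. h_poly (GZ ([1, 2] @ replicate k 3))) = s * G + E"
    by (rule fps_ext) (simp add: h_poly_GZ_eq_word_sum s_def G_def E_def)
  have B: "Abs_fps (\<lambda>k. h_poly (GZ ([2, 2] @ replicate k 3))) = E"
    by (rule fps_ext) (simp add: h_poly_GZ_eq_word_sum E_def)
  \<comment> \<open>Constant term 1 of every factor justifies passing between quotients and
    products.\<close>
  have D0: "fps_nth (s^2 * z^2 - (s^2 + s) * z + 1) 0 = 1" "fps_nth (1 - z) 0 = 1" "fps_nth (1 - s * z) 0 = 1"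
    by (simp_all add: z_def power2_eq_square)
  have "s * G + E = fps_quotient (- s * z + s + 1)
      ((1 - z) * (1 - s * z) * (s^2 * z^2 - (s^2 + s) * z + 1))"
    using word_sum_fps(2)[of "[:-1, 1:] :: int poly"]
    unfolding s[symmetric] E_def[symmetric] G_def[symmetric] z_def[symmetric]
    by (subst fps_quotient_iff) (simp_all only: fps_mult_nth_0 D0 mult_1_left)
  moreover have "E = fps_quotient 1 ((1 - z) * (s^2 * z^2 - (s^2 + s) * z + 1))"
    using word_sum_fps(1)[of "[:-1, 1:] :: int poly"]
    unfolding s[symmetric] E_def[symmetric] z_def[symmetric]
    by (subst fps_quotient_iff) (simp_all only: fps_mult_nth_0 D0 mult_1_left)
  ultimately show ?thesis
    unfolding Let_def s_def[symmetric] z_def[symmetric] A B by blast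
qed

end
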